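(* For any topological spaces $X$ and $Y$, the following conditions are equivalent: (1) the product $X\times Y$ is $\mathbb R$-factorizable; (2) any cozero set in $X\times Y$ is a countable union of cozero rectangles; (3) $X\times Y$ is $z$-embedded in $\beta X\times \beta Y$; (4) whenever $X$ is a $z$-embedded subspace of a space $X'$ and $Y$ is a $z$-embedded subspace of a space $Y'$, the product $X\times Y$ is $z$-embedded in $X'\times Y'$; (5) there exist spaces $X'\supset X$ and $Y'\supset Y$ (containing $X$ and $Y$ as subspaces) such that the product $X'\times Y'$ is $\mathbb R$-factorizable and $X\times Y$ is $z$-embedded in $X'\times Y'$; (6) there exist spaces $X'\supset X$ and $Y'\supset Y$ (containing $X$ and $Y$ as subspaces) such that $X'\times Y'$ is Lindelöf and $X\times Y$ is $z$-embedded in $X'\times Y'$.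
   Context: All topological spaces are assumed to be Tychonoff (including Hausdorff). A product $X\times Y$ of topological spaces is (multiplicatively) $\mathbb R$-factorizable if for any continuous function $f\colon X\times Y\to\mathbb R$ there exist second-countable spaces $X',Y'$ and continuous maps $g_1\colon X\to X'$, $g_2\colon Y\to Y'$, and $h\colon X'\times Y'\to\mathbb R$ such that $f=h\circ(g_1\times g_2)$. A zero set in a space is a set of the form $f^{-1}(\{0\})$ for a continuous real-valued function $f$; a cozero set is the complement of a zero set. A cozero rectangle in $X\times Y$ is a set $V\times W$ with $V$ a cozero set in $X$ and $W$ a cozero set in $Y$. A subspace $S$ of a space $T$ is $z$-embedded in $T$ if for every zero set $Z$ in $S$ there is a zero set $F$ in $T$ with $F\cap S=Z$. $\beta X$ is the Stone–Čech compactification of $X$. *)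

theory Defs
  imports "HOL-Analysis.Analysis"
begin

definition tychonoff_space :: "'a topology \<Rightarrow> bool" where
  "tychonoff_space X \<longleftrightarrow> completely_regular_space X \<and> Hausdorff_space X"

definition zero_set_of :: "'a topology \<Rightarrow> 'a set \<Rightarrow> bool" where
  "zero_set_of X Z \<longleftrightarrow>
     (\<exists>f. continuous_map X euclideanreal f \<and> Z = {x \<in> topspace X. f x = 0})"

definition cozero_set_of :: "'a topology \<Rightarrow> 'a set \<Rightarrow> bool" where
  "cozero_set_of X C \<longleftrightarrow> (\<exists>Z. zero_set_of X Z \<and> C = topspace X - Z)"

definition cozero_rectangle :: "'a topology \<Rightarrow> 'b topology \<Rightarrow> ('a \<times> 'b) set \<Rightarrow> bool" where
  "cozero_rectangle X Y R \<longleftrightarrow>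
     (\<exists>V W. cozero_set_of X V \<and> cozero_set_of Y W \<and> R = V \<times> W)"

definition z_embedded_in :: "'a set \<Rightarrow> 'a topology \<Rightarrow> bool" where
  "z_embedded_in S T \<longleftrightarrow>
     S \<subseteq> topspace T \<and>
     (\<forall>Z. zero_set_of (subtopology T S) Z \<longrightarrow> (\<exists>F. zero_set_of T F \<and> F \<inter> S = Z))"

text \<open>
  Multiplicative \<open>\<real>\<close>-factorizability of the product of \<open>X\<close> and \<open>Y\<close>. A second-countable
  Hausdorff space has at most continuum many points, so up to homeomorphism it lives on a
  subset of the reals; hence quantifying over topologies of type \<^typ>\<open>real topology\<close> is no
  restriction (lemma \<open>factorization_through_real_copies\<close> below).
\<close>

definition R_factorizable_prod :: "'a topology \<Rightarrow> 'b topology \<Rightarrow> bool" where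
  "R_factorizable_prod X Y \<longleftrightarrow>
     (\<forall>f. continuous_map (prod_topology X Y) euclideanreal f \<longrightarrow>
        (\<exists>(X' :: real topology) (Y' :: real topology) g1 g2 h.
           tychonoff_space X' \<and> second_countable X' \<and>
           tychonoff_space Y' \<and> second_countable Y' \<and>
           continuous_map X X' g1 \<and> continuous_map Y Y' g2 \<and>
           continuous_map (prod_topology X' Y') euclideanreal h \<and>
           (\<forall>x \<in> topspace X. \<forall>y \<in> topspace Y. f (x, y) = h (g1 x, g2 y))))"

text \<open>
  The Stone--Cech compactification, constructed as the closure of the image of \<open>X\<close> in the
  Tychonoff cube indexed by the continuous functions from \<open>X\<close> to \<open>[0,1]\<close>. Functions are taken
  extensional so that each continuous function gives exactly one coordinate.
\<close>

definition unit_functions :: "'a topology \<Rightarrow> ('a \<Rightarrow> real) set" where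
  "unit_functions X =
     {f. continuous_map X (top_of_set {0..1}) f \<and> f \<in> extensional (topspace X)}"

definition unit_cube :: "'a topology \<Rightarrow> (('a \<Rightarrow> real) \<Rightarrow> real) topology" where
  "unit_cube X = product_topology (\<lambda>f. top_of_set {0..1}) (unit_functions X)"

definition beta_map :: "'a topology \<Rightarrow> 'a \<Rightarrow> (('a \<Rightarrow> real) \<Rightarrow> real)" where
  "beta_map X x = (\<lambda>f \<in> unit_functions X. f x)"

definition beta :: "'a topology \<Rightarrow> (('a \<Rightarrow> real) \<Rightarrow> real) topology" where
  "beta X = subtopology (unit_cube X) (unit_cube X closure_of (beta_map X ` topspace X))"

text \<open>
  The conditions quantifying over spaces that contain \<open>X\<close> and \<open>Y\<close>. Since \<open>X'\<close> may need a larger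
  point type than \<open>X\<close>, being a subspace is expressed by an embedding map. HOL formulas cannot
  quantify over types, so the point types of \<open>X'\<close> and \<open>Y'\<close> are parameters.
  Quantification over all spaces is recovered by taking a type large enough to carry
  \<^term>\<open>beta X\<close>, together with the one-directional implications at arbitrary types.
\<close>

definition z_embedded_in_all_z_extensions ::
  "'c itself \<Rightarrow> 'd itself \<Rightarrow> 'a topology \<Rightarrow> 'b topology \<Rightarrow> bool" where
  "z_embedded_in_all_z_extensions TYPE('c) TYPE('d) X Y \<longleftrightarrow>
     (\<forall>(X' :: 'c topology) (Y' :: 'd topology) i j.
        tychonoff_space X' \<and> tychonoff_space Y' \<and>
        embedding_map X X' i \<and> embedding_map Y Y' j \<and>
        z_embedded_in (i ` topspace X) X' \<and> z_embedded_in (j ` topspace Y) Y' \<longrightarrow>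
        z_embedded_in ((i ` topspace X) \<times> (j ` topspace Y)) (prod_topology X' Y'))"

definition z_embedded_in_some_R_factorizable_prod ::
  "'c itself \<Rightarrow> 'd itself \<Rightarrow> 'a topology \<Rightarrow> 'b topology \<Rightarrow> bool" where
  "z_embedded_in_some_R_factorizable_prod TYPE('c) TYPE('d) X Y \<longleftrightarrow>
     (\<exists>(X' :: 'c topology) (Y' :: 'd topology) i j.
        tychonoff_space X' \<and> tychonoff_space Y' \<and>
        embedding_map X X' i \<and> embedding_map Y Y' j \<and>
        R_factorizable_prod X' Y' \<and>
        z_embedded_in ((i ` topspace X) \<times> (j ` topspace Y)) (prod_topology X' Y'))"

definition z_embedded_in_some_Lindelof_prod ::
  "'c itself \<Rightarrow> 'd itself \<Rightarrow> 'a topology \<Rightarrow> 'b topology \<Rightarrow> bool" where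
  "z_embedded_in_some_Lindelof_prod TYPE('c) TYPE('d) X Y \<longleftrightarrow>
     (\<exists>(X' :: 'c topology) (Y' :: 'd topology) i j.
        tychonoff_space X' \<and> tychonoff_space Y' \<and>
        embedding_map X X' i \<and> embedding_map Y Y' j \<and>
        Lindelof_space (prod_topology X' Y') \<and>
        z_embedded_in ((i ` topspace X) \<times> (j ` topspace Y)) (prod_topology X' Y'))"


lemma second_countable_tychonoff_real_copy:
  fixes X :: "'a topology"
  assumes "tychonoff_space X" "second_countable X"
  obtains X' :: "real topology" and p q where
    "tychonoff_space X'" "second_countable X'" "homeomorphic_maps X X' p q"
proof -
  from assms(2) obtain \<B> where B: "countable \<B>" "\<forall>V \<in> \<B>. openin X V"
    "\<forall>U x. openin X U \<and> x \<in> U \<longrightarrow> (\<exists>V \<in> \<B>. x \<in> V \<and> V \<subseteq> U)"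
    unfolding second_countable_def by metis
  obtain c :: "nat set \<Rightarrow> real" where c: "inj c"
    using nat_sets_eqpoll_reals unfolding eqpoll_def bij_betw_def by blast
  define p where "p \<equiv> \<lambda>x. c (to_nat_on \<B> ` {V \<in> \<B>. x \<in> V})"
  have inj: "inj_on p (topspace X)"
  proof (rule inj_onI, rule ccontr)
    fix x y assume xy: "x \<in> topspace X" "y \<in> topspace X" "p x = p y" "x \<noteq> y"
    then obtain U where U: "openin X U" "x \<in> U" "y \<notin> U"
      using assms(1) unfolding tychonoff_space_def Hausdorff_space_def disjnt_iff by metis
    then obtain V where V: "V \<in> \<B>" "x \<in> V" "V \<subseteq> U" using B(3) by blast
    have "to_nat_on \<B> ` {V \<in> \<B>. x \<in> V} = to_nat_on \<B> ` {V \<in> \<B>. y \<in> V}"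
      using xy(3) c unfolding p_def inj_def by blast
    then have "{V \<in> \<B>. x \<in> V} = {V \<in> \<B>. y \<in> V}"
      using inj_on_to_nat_on[OF B(1)] by (subst (asm) inj_on_image_eq_iff) auto
    then show False using V U by blast
  qed
  define q where "q = inv_into (topspace X) p"
  define X' where "X' = pullback_topology (p ` topspace X) q X"
  have qp: "q (p x) = x" if "x \<in> topspace X" for x
    using inj that unfolding q_def by simp
  have top: "topspace X' = p ` topspace X"
    unfolding X'_def topspace_pullback_topology using qp by auto
  have hom: "homeomorphic_maps X X' p q"
    unfolding homeomorphic_maps_def
  proof (intro conjI ballI)
    show "continuous_map X X' p"
      unfolding X'_def
      by (rule continuous_map_pullback')
         (auto intro: continuous_map_eq[OF continuous_map_id] simp: qp)
    show "continuous_map X' X q"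
      unfolding X'_def using continuous_map_pullback[OF continuous_map_id, where A = "p ` topspace X" and f = q]
      by simp
  qed (auto simp: top qp)
  then have hs: "X homeomorphic_space X'" unfolding homeomorphic_space_def by blast
  have "tychonoff_space X'"
    using assms(1) homeomorphic_completely_regular_space[OF hs] homeomorphic_Hausdorff_space[OF hs]
    unfolding tychonoff_space_def by blast
  moreover have "second_countable X'"
    using assms(2) homeomorphic_space_second_countability[OF hs] by blast
  ultimately show thesis using hom that by blast
qed

lemma factorization_through_real_copies:
  fixes X :: "'a topology" and Y :: "'b topology"
    and X' :: "'c topology" and Y' :: "'d topology"
  assumes "tychonoff_space X'" "second_countable X'" "tychonoff_space Y'" "second_countable Y'"
    and "continuous_map X X' g1" "continuous_map Y Y' g2"
    and "continuous_map (prod_topology X' Y') euclideanreal h"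
    and "\<forall>x \<in> topspace X. \<forall>y \<in> topspace Y. f (x, y) = h (g1 x, g2 y)"
  shows "\<exists>(X' :: real topology) (Y' :: real topology) g1 g2 h.
           tychonoff_space X' \<and> second_countable X' \<and>
           tychonoff_space Y' \<and> second_countable Y' \<and>
           continuous_map X X' g1 \<and> continuous_map Y Y' g2 \<and>
           continuous_map (prod_topology X' Y') euclideanreal h \<and>
           (\<forall>x \<in> topspace X. \<forall>y \<in> topspace Y. f (x, y) = h (g1 x, g2 y))"
proof -
  obtain X'' :: "real topology" and p q where
    X: "tychonoff_space X''" "second_countable X''" "homeomorphic_maps X' X'' p q"
    using second_countable_tychonoff_real_copy assms(1,2) by blast
  obtain Y'' :: "real topology" and r s where
    Y: "tychonoff_space Y''" "second_countable Y''" "homeomorphic_maps Y' Y'' r s"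
    using second_countable_tychonoff_real_copy assms(3,4) by blast
  have 1: "continuous_map X X'' (p \<circ> g1)" "continuous_map Y Y'' (r \<circ> g2)"
    using X(3) Y(3) assms(5,6) continuous_map_compose unfolding homeomorphic_maps_def by blast+
  have 2: "continuous_map (prod_topology X'' Y'') euclideanreal (h \<circ> (\<lambda>(x, y). (q x, s y)))"
    using X(3) Y(3) assms(7) unfolding homeomorphic_maps_def
    by (intro continuous_map_compose[where X' = "prod_topology X' Y'"])
       (auto simp: continuous_map_prod_top)
  have 3: "f (x, y) = (h \<circ> (\<lambda>(x, y). (q x, s y))) ((p \<circ> g1) x, (r \<circ> g2) y)"
    if "x \<in> topspace X" "y \<in> topspace Y" for x y
  proof -
    have "g1 x \<in> topspace X'" "g2 y \<in> topspace Y'"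
      using that assms(5,6) by (auto simp: continuous_map_def)
    then show ?thesis
      using X(3) Y(3) assms(8) that by (simp add: homeomorphic_maps_def)
  qed
  show ?thesis using X Y 1 2 3 by blast
qed

lemma embedding_map_beta_map:
  assumes "tychonoff_space X"
  shows "embedding_map X (beta X) (beta_map X)"
proof -
  have eq: "unit_functions X =
      mspace (submetric (cfunspace X euclidean_metric) {f. f \<in> topspace X \<rightarrow> {0..1}})"
    by (auto simp: unit_functions_def continuous_map_in_subtopology image_subset_iff_funcset
        intro: bounded_subset[OF bounded_closed_interval[of 0 1]])
  have emb: "embedding_map X (unit_cube X) (beta_map X)"
    using completely_regular_space_cube_embedding_explicit[of X] assms
    unfolding unit_cube_def beta_map_def eq tychonoff_space_def by blast
  then have "beta_map X ` topspace X \<subseteq> topspace (unit_cube X)"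
    unfolding embedding_map_def
    by (meson continuous_map_image_subset_topspace continuous_map_in_subtopology
        homeomorphic_imp_continuous_map)
  then show ?thesis
    unfolding beta_def embedding_map_in_subtopology using emb closure_of_subset by blast
qed

lemma compact_Hausdorff_beta: "compact_space (beta X)" "Hausdorff_space (beta X)"
proof -
  have "compact_space (unit_cube X)"
    unfolding unit_cube_def compact_space_product_topology by (simp add: compact_space_subtopology)
  then show "compact_space (beta X)"
    unfolding beta_def by (simp add: closedin_compact_space compact_space_subtopology)
  show "Hausdorff_space (beta X)"
    unfolding beta_def unit_cube_def
    by (intro Hausdorff_space_subtopology) (simp add: Hausdorff_space_product_topology Hausdorff_space_subtopology)
qed

lemma beta_map_dense:
  assumes "tychonoff_space X"
  shows "beta X closure_of (beta_map X ` topspace X) = topspace (beta X)"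
proof -
  let ?S = "beta_map X ` topspace X"
  have "?S \<subseteq> topspace (beta X)"
    using embedding_map_beta_map[OF assms] unfolding embedding_map_def
    by (meson continuous_map_image_subset_topspace continuous_map_in_subtopology
        homeomorphic_imp_continuous_map)
  then have sub: "?S \<subseteq> unit_cube X closure_of ?S" by (simp add: beta_def)
  show ?thesis
    unfolding beta_def closure_of_subtopology
    using sub closure_of_subset_topspace[of "unit_cube X" ?S] by (auto simp: Int_absorb1)
qed

lemma beta_extension:
  assumes "continuous_map X (top_of_set {0..1}) f"
  obtains F where "continuous_map (beta X) (top_of_set {0..1::real}) F"
    "\<And>x. x \<in> topspace X \<Longrightarrow> F (beta_map X x) = f x"
proof
  let ?f = "restrict f (topspace X)"
  have "continuous_map X (top_of_set {0..1}) ?f"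
    using assms by (rule continuous_map_eq) auto
  then have f: "?f \<in> unit_functions X" by (simp add: unit_functions_def)
  show "continuous_map (beta X) (top_of_set {0..1}) (\<lambda>u. u ?f)"
    unfolding beta_def unit_cube_def
    by (intro continuous_map_from_subtopology continuous_map_product_projection f)
  show "beta_map X x ?f = f x" if "x \<in> topspace X" for x
    using that f by (simp add: beta_map_def)
qed

end

theory Submission
  imports Defs
begin

text \<open>
  All conditions are compared with (2). Cozero rectangles pull back along products of maps, so (2)
  holds for \<open>X \<times> Y\<close> as soon as it holds for a product in which \<open>X \<times> Y\<close> is \<open>z\<close>-embedded, and it
  holds for every Lindelof product of Tychonoff spaces because cozero sets are \<open>F\<^sub>\<sigma>\<close>. Conversely,
  under (2) every cozero set of \<open>X \<times> Y\<close> extends to \<open>X' \<times> Y'\<close> by extending the sides of its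
  rectangles. All spaces needed for (5) and (6) are supplied by \<open>\<beta> X\<close> and \<open>\<beta> Y\<close>.
\<close>

section \<open>Cozero sets and cozero rectangles\<close>

lemma cozero_set_of_iff:
  "cozero_set_of X C \<longleftrightarrow>
     (\<exists>f. continuous_map X euclideanreal f \<and> C = {x \<in> topspace X. f x \<noteq> 0})"
  unfolding cozero_set_of_def zero_set_of_def by blast

text \<open>Allows \<open>z\<close>-embedding to be treated through cozero sets alone. The inclusion
  is required on the right because \<open>topspace X - Z\<close> forgets the points of
  \<open>Z\<close> outside the space.\<close>

lemma zero_set_of_iff_cozero:
  "zero_set_of X Z \<longleftrightarrow> Z \<subseteq> topspace X \<and> cozero_set_of X (topspace X - Z)"
  unfolding cozero_set_of_def by (auto simp: zero_set_of_def double_diff)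

lemma openin_cozero_set:
  assumes "cozero_set_of X C"
  shows "openin X C"
proof -
  obtain f where f: "continuous_map X euclideanreal f" "C = {x \<in> topspace X. f x \<noteq> 0}"
    using assms unfolding cozero_set_of_iff by blast
  then show ?thesis
    using openin_continuous_map_preimage[OF f(1), of "- {0}"] by (simp add: open_Compl)
qed

lemma cozero_set_of_preimage:
  assumes "continuous_map X Y g" "cozero_set_of Y D"
  shows "cozero_set_of X {x \<in> topspace X. g x \<in> D}"
proof -
  obtain f where f: "continuous_map Y euclideanreal f" "D = {y \<in> topspace Y. f y \<noteq> 0}"
    using assms(2) unfolding cozero_set_of_iff by blast
  have "{x \<in> topspace X. g x \<in> D} = {x \<in> topspace X. (f \<circ> g) x \<noteq> 0}"
    using assms(1) f(2) by (auto simp: continuous_map_def)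
  then show ?thesis
    unfolding cozero_set_of_iff using continuous_map_compose[OF assms(1) f(1)] by blast
qed

lemma cozero_set_of_empty: "cozero_set_of X {}"
  unfolding cozero_set_of_iff by (rule exI[of _ "\<lambda>_. 0"]) simp

text \<open>
  Bundling the functions into one map to the metrizable space of sequences, the union is the
  cozero set of the distance to the zero sequence.
\<close>

lemma cozero_set_of_UN:
  fixes C :: "nat \<Rightarrow> 'a set"
  assumes "\<And>n. cozero_set_of X (C n)"
  shows "cozero_set_of X (\<Union>n. C n)"
proof -
  obtain f where f: "\<And>n. continuous_map X euclideanreal (f n)"
    "\<And>n. C n = {x \<in> topspace X. f n x \<noteq> 0}"
    using assms unfolding cozero_set_of_iff by metis
  define F :: "'a \<Rightarrow> nat \<Rightarrow> real" where "F x = (\<lambda>n. f n x)" for x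
  have "continuous_map X euclidean F"
    unfolding euclidean_product_topology[symmetric] continuous_map_componentwise_UNIV F_def
    using f(1) by simp
  moreover have "continuous_map euclidean euclideanreal (\<lambda>u::nat \<Rightarrow> real. dist u (\<lambda>_. 0))"
    by (simp add: continuous_on_dist)
  ultimately have "continuous_map X euclideanreal ((\<lambda>u. dist u (\<lambda>_. 0)) \<circ> F)"
    by (rule continuous_map_compose)
  moreover have "(\<Union>n. C n) = {x \<in> topspace X. ((\<lambda>u. dist u (\<lambda>_. 0)) \<circ> F) x \<noteq> 0}"
    by (auto simp: f(2) F_def fun_eq_iff)
  ultimately show ?thesis unfolding cozero_set_of_iff by blast
qed

lemma cozero_rectangle_iff:
  "cozero_rectangle X Y R \<longleftrightarrow>
     (\<exists>v w. continuous_map X euclideanreal v \<and> continuous_map Y euclideanreal w \<and>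
        R = {x \<in> topspace X. v x \<noteq> 0} \<times> {y \<in> topspace Y. w y \<noteq> 0})"
  unfolding cozero_rectangle_def cozero_set_of_iff by blast

lemma cozero_rectangle_empty: "cozero_rectangle X Y {}"
  unfolding cozero_rectangle_def by (intro exI[of _ "{}"]) (simp add: cozero_set_of_empty)

text \<open>A product \<open>v x * w y\<close> is nonzero exactly when both factors are.\<close>

lemma cozero_set_of_cozero_rectangle:
  assumes "cozero_rectangle X Y R"
  shows "cozero_set_of (prod_topology X Y) R"
proof -
  obtain v w where vw: "continuous_map X euclideanreal v" "continuous_map Y euclideanreal w"
    "R = {x \<in> topspace X. v x \<noteq> 0} \<times> {y \<in> topspace Y. w y \<noteq> 0}"
    using assms unfolding cozero_rectangle_iff by blast
  have "continuous_map (prod_topology X Y) euclideanreal (\<lambda>z. v (fst z) * w (snd z))"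
    using continuous_map_compose[OF continuous_map_fst vw(1), of Y]
      continuous_map_compose[OF continuous_map_snd vw(2), of X]
    by (intro continuous_map_real_mult) (simp_all add: o_def)
  moreover have "R = {z \<in> topspace (prod_topology X Y). v (fst z) * w (snd z) \<noteq> 0}"
    using vw(3) by auto
  ultimately show ?thesis unfolding cozero_set_of_iff by (intro exI conjI)
qed

lemma continuous_map_map_prod:
  assumes "continuous_map X X' g1" "continuous_map Y Y' g2"
  shows "continuous_map (prod_topology X Y) (prod_topology X' Y') (map_prod g1 g2)"
  unfolding map_prod_def using assms by (simp add: continuous_map_prod_top)

section \<open>Countable unions of cozero rectangles\<close>

definition sigma_cozero_rectangle :: "'a topology \<Rightarrow> 'b topology \<Rightarrow> ('a \<times> 'b) set \<Rightarrow> bool" where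
  "sigma_cozero_rectangle X Y C \<longleftrightarrow>
     (\<exists>\<R>. countable \<R> \<and> (\<forall>R \<in> \<R>. cozero_rectangle X Y R) \<and> C = \<Union>\<R>)"

lemma sigma_cozero_rectangle_sequence:
  "sigma_cozero_rectangle X Y C \<longleftrightarrow>
     (\<exists>R :: nat \<Rightarrow> _. (\<forall>n. cozero_rectangle X Y (R n)) \<and> C = (\<Union>n. R n))"
  (is "_ \<longleftrightarrow> ?rhs")
proof
  assume "sigma_cozero_rectangle X Y C"
  then obtain \<R> where R: "countable \<R>" "\<And>R. R \<in> \<R> \<Longrightarrow> cozero_rectangle X Y R" "C = \<Union>\<R>"
    unfolding sigma_cozero_rectangle_def by blast
  \<comment> \<open>Enumeration by \<open>from_nat_into\<close> requires a nonempty family. The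
    empty rectangle secures this and leaves the union unchanged; a finite family is listed with
    repetitions.\<close>
  let ?S = "insert {} \<R>"
  have range: "range (from_nat_into ?S) = ?S" using R(1) by (intro range_from_nat_into) auto
  have "\<forall>R \<in> ?S. cozero_rectangle X Y R" using R(2) by (simp add: cozero_rectangle_empty)
  then have "\<forall>n. cozero_rectangle X Y (from_nat_into ?S n)"
    using from_nat_into[of ?S] by (metis insert_not_empty)
  moreover have "C = (\<Union>n. from_nat_into ?S n)" using range R(3) by simp
  ultimately show ?rhs by blast
next
  assume ?rhs
  then obtain R :: "nat \<Rightarrow> _" where "\<forall>n. cozero_rectangle X Y (R n)" "C = (\<Union>n. R n)" by blast
  then show "sigma_cozero_rectangle X Y C"
    unfolding sigma_cozero_rectangle_def by (intro exI[of _ "range R"]) auto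
qed

text \<open>Preimages commute with unions, and the preimage of a rectangle under a product map is
  the rectangle of the preimages of its sides. Used below for the two maps of a factorization and
  for a pair of embeddings.\<close>

lemma sigma_cozero_rectangle_preimage:
  assumes "continuous_map X X' g1" "continuous_map Y Y' g2" "sigma_cozero_rectangle X' Y' D"
  shows "sigma_cozero_rectangle X Y {z \<in> topspace (prod_topology X Y). map_prod g1 g2 z \<in> D}"
proof -
  obtain \<R> where R: "countable \<R>" "\<And>R. R \<in> \<R> \<Longrightarrow> cozero_rectangle X' Y' R" "D = \<Union>\<R>"
    using assms(3) unfolding sigma_cozero_rectangle_def by blast
  let ?p = "\<lambda>R. {z \<in> topspace (prod_topology X Y). map_prod g1 g2 z \<in> R}"
  have "cozero_rectangle X Y (?p R)" if R': "R \<in> \<R>" for R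
  proof -
    obtain V W where VW: "cozero_set_of X' V" "cozero_set_of Y' W" "R = V \<times> W"
      using R(2)[OF R'] unfolding cozero_rectangle_def by blast
    have "?p R = {x \<in> topspace X. g1 x \<in> V} \<times> {y \<in> topspace Y. g2 y \<in> W}"
      by (auto simp: VW(3))
    then show ?thesis
      unfolding cozero_rectangle_def
      using cozero_set_of_preimage[OF assms(1) VW(1)] cozero_set_of_preimage[OF assms(2) VW(2)]
      by blast
  qed
  moreover have "?p D = \<Union>(?p ` \<R>)" by (auto simp: R(3))
  ultimately show ?thesis
    unfolding sigma_cozero_rectangle_def using R(1) by (intro exI[of _ "?p ` \<R>"]) auto
qed

section \<open>Lindelof products\<close>

lemma cozero_neighbourhood:
  assumes "completely_regular_space X" "openin X U" "x \<in> U"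
  obtains V where "cozero_set_of X V" "x \<in> V" "V \<subseteq> U"
proof -
  obtain f where f: "continuous_map X euclideanreal f" "f x = 0" "f ` (topspace X - U) \<subseteq> {1}"
    using assms unfolding completely_regular_space_alt' by blast
  \<comment> \<open>The separating function is 0 at \<open>x\<close> and 1 off \<open>U\<close>, so
    \<open>f - 1\<close> is nonzero at \<open>x\<close> and vanishes off \<open>U\<close>.\<close>
  show thesis
  proof
    show "cozero_set_of X {x \<in> topspace X. f x - 1 \<noteq> 0}"
      unfolding cozero_set_of_iff using f(1)
      by (intro exI[of _ "\<lambda>x. f x - 1"] conjI continuous_map_diff) auto
    show "x \<in> {x \<in> topspace X. f x - 1 \<noteq> 0}"
      using assms(2,3) f(2) openin_subset by fastforce
    show "{x \<in> topspace X. f x - 1 \<noteq> 0} \<subseteq> U" using f(3) by auto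
  qed
qed

lemma openin_prod_topology_box:
  assumes "openin (prod_topology X Y) U" "z \<in> U"
  obtains V W where "openin X V" "openin Y W" "fst z \<in> V" "snd z \<in> W" "V \<times> W \<subseteq> U"
proof -
  have "(fst z, snd z) \<in> U" using assms(2) by simp
  then have "\<exists>V W. openin X V \<and> openin Y W \<and> fst z \<in> V \<and> snd z \<in> W \<and> V \<times> W \<subseteq> U"
    using assms(1) unfolding openin_prod_topology_alt by (elim allE impE)
  then show thesis using that by (elim exE conjE)
qed

text \<open>Each point of \<open>U\<close> has an open box inside \<open>U\<close>, and complete
  regularity shrinks its sides to cozero sets. These rectangles form an open cover of
  \<open>U\<close>; since all of them lie in \<open>U\<close>, the union of a countable subcover is
  exactly \<open>U\<close>. The Lindelof property is asked of \<open>U\<close> itself because open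
  subspaces do not inherit it in general.\<close>

lemma sigma_cozero_rectangle_Lindelof:
  assumes "completely_regular_space X" "completely_regular_space Y"
    and U: "openin (prod_topology X Y) U" "Lindelof_space (subtopology (prod_topology X Y) U)"
  shows "sigma_cozero_rectangle X Y U"
proof -
  let ?\<U> = "{R. cozero_rectangle X Y R \<and> R \<subseteq> U}"
  have "\<exists>R \<in> ?\<U>. z \<in> R" if z: "z \<in> U" for z
  proof -
    obtain A B where AB: "openin X A" "openin Y B" "fst z \<in> A" "snd z \<in> B" "A \<times> B \<subseteq> U"
      using openin_prod_topology_box[OF U(1) z] .
    obtain V where V: "cozero_set_of X V" "fst z \<in> V" "V \<subseteq> A"
      using cozero_neighbourhood[OF assms(1) AB(1,3)] .
    obtain W where W: "cozero_set_of Y W" "snd z \<in> W" "W \<subseteq> B"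
      using cozero_neighbourhood[OF assms(2) AB(2,4)] .
    have "cozero_rectangle X Y (V \<times> W)"
      unfolding cozero_rectangle_def using V(1) W(1) by blast
    moreover have "V \<times> W \<subseteq> U" using AB(5) V(3) W(3) by blast
    moreover have "z \<in> V \<times> W" using V(2) W(2) by (simp add: mem_Times_iff)
    ultimately show ?thesis by (intro bexI[of _ "V \<times> W"] CollectI conjI)
  qed
  then have cover: "U \<subseteq> \<Union>?\<U>" by blast
  have "\<forall>R \<in> ?\<U>. openin (prod_topology X Y) R"
    using cozero_set_of_cozero_rectangle openin_cozero_set by blast
  then have "\<exists>\<V>. countable \<V> \<and> \<V> \<subseteq> ?\<U> \<and> U \<subseteq> \<Union>\<V>"
    by (intro U(2)[unfolded Lindelof_space_subtopology_subset[OF openin_subset[OF U(1)]], rule_format]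
        conjI cover)
  then obtain \<V> where "countable \<V>" "\<V> \<subseteq> ?\<U>" "U \<subseteq> \<Union>\<V>"
    by (elim exE conjE)
  then show ?thesis
    unfolding sigma_cozero_rectangle_def by (intro exI[of _ \<V>]) auto
qed

text \<open>A cozero set is an F-sigma set, closed subspaces of a Lindelof space are Lindelof, and a
  countable union of Lindelof subspaces is again Lindelof.\<close>

lemma Lindelof_space_cozero_set:
  assumes "Lindelof_space X" "cozero_set_of X C"
  shows "Lindelof_space (subtopology X C)"
proof -
  obtain f where f: "continuous_map X euclideanreal f" "C = {x \<in> topspace X. f x \<noteq> 0}"
    using assms(2) unfolding cozero_set_of_iff by blast
  \<comment> \<open>The closed pieces are the sets where the absolute value of \<open>f\<close> is
    at least 1/(n+1); \<open>Suc\<close> avoids the reciprocal of 0. By the Archimedean property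
    they exhaust the set where \<open>f\<close> is nonzero.\<close>
  define K where "K n = {x \<in> topspace X. f x \<in> {t. inverse (real (Suc n)) \<le> \<bar>t\<bar>}}" for n
  have "closedin X (K n)" for n
    unfolding K_def
    by (rule closedin_continuous_map_preimage[OF f(1)])
       (simp add: closed_Collect_le continuous_intros)
  then have "Lindelof_space (subtopology X (\<Union>(range K)))"
    using assms(1) Lindelof_space_closedin_subtopology by (intro Lindelof_space_Union) auto
  moreover have "\<Union>(range K) = C"
  proof -
    have "(\<exists>n. inverse (real (Suc n)) \<le> \<bar>t\<bar>) \<longleftrightarrow> t \<noteq> 0" for t :: real
    proof
      assume "t \<noteq> 0"
      then show "\<exists>n. inverse (real (Suc n)) \<le> \<bar>t\<bar>"
        using reals_Archimedean[of "\<bar>t\<bar>"] by (meson less_imp_le zero_less_abs_iff)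
    qed auto
    then show ?thesis unfolding K_def f(2) by auto
  qed
  ultimately show ?thesis by simp
qed

lemma cozero_imp_sigma_cozero_rectangle_Lindelof:
  assumes "completely_regular_space X" "completely_regular_space Y"
    and "Lindelof_space (prod_topology X Y)" "cozero_set_of (prod_topology X Y) C"
  shows "sigma_cozero_rectangle X Y C"
  using sigma_cozero_rectangle_Lindelof[OF assms(1,2) openin_cozero_set[OF assms(4)]]
    Lindelof_space_cozero_set[OF assms(3,4)] by blast

section \<open>Second-countable spaces\<close>

lemma second_countable_prod_topology:
  assumes "second_countable X" "second_countable Y"
  shows "second_countable (prod_topology X Y)"
proof -
  obtain \<A> where A: "countable \<A>" "\<forall>V \<in> \<A>. openin X V"
    "\<forall>U x. openin X U \<and> x \<in> U \<longrightarrow> (\<exists>V \<in> \<A>. x \<in> V \<and> V \<subseteq> U)"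
    using assms(1) unfolding second_countable_def by (elim exE conjE) (rule that)
  obtain \<B> where B: "countable \<B>" "\<forall>V \<in> \<B>. openin Y V"
    "\<forall>U x. openin Y U \<and> x \<in> U \<longrightarrow> (\<exists>V \<in> \<B>. x \<in> V \<and> V \<subseteq> U)"
    using assms(2) unfolding second_countable_def by (elim exE conjE) (rule that)
  let ?C = "(\<lambda>(V, W). V \<times> W) ` (\<A> \<times> \<B>)"
  have "\<exists>R \<in> ?C. z \<in> R \<and> R \<subseteq> U" if z: "openin (prod_topology X Y) U" "z \<in> U" for U z
  proof -
    obtain V W where VW: "openin X V" "openin Y W" "fst z \<in> V" "snd z \<in> W" "V \<times> W \<subseteq> U"
      using openin_prod_topology_box[OF z] .
    obtain V' where V': "V' \<in> \<A>" "fst z \<in> V'" "V' \<subseteq> V" using A(3) VW(1,3) by meson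
    obtain W' where W': "W' \<in> \<B>" "snd z \<in> W'" "W' \<subseteq> W" using B(3) VW(2,4) by meson
    have "V' \<times> W' \<in> ?C" using V'(1) W'(1) by auto
    moreover have "V' \<times> W' \<subseteq> U" using VW(5) V'(3) W'(3) by blast
    moreover have "z \<in> V' \<times> W'" using V'(2) W'(2) by (simp add: mem_Times_iff)
    ultimately show ?thesis by (intro bexI[of _ "V' \<times> W'"] conjI)
  qed
  then show ?thesis
    unfolding second_countable_def using A(1,2) B(1,2)
    by (intro exI[of _ ?C]) (auto simp: openin_prod_Times_iff)
qed

lemma second_countable_euclidean: "second_countable (euclidean :: 'a::second_countable_topology topology)"
proof -
  obtain \<B> :: "'a set set" where B: "countable \<B>" "topological_basis \<B>"
    using ex_countable_basis by blast
  have "open V" if "V \<in> \<B>" for V using topological_basis_open[OF B(2) that] .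
  moreover have "\<exists>V \<in> \<B>. x \<in> V \<and> V \<subseteq> U" if "open U" "x \<in> U" for U x
    by (rule topological_basisE[OF B(2) that]) blast
  ultimately show ?thesis unfolding second_countable_def using B(1) by (intro exI[of _ \<B>]) auto
qed

lemma tychonoff_space_metrizable: "metrizable_space X \<Longrightarrow> tychonoff_space X"
  unfolding tychonoff_space_def
  by (simp add: metrizable_imp_completely_regular_space metrizable_imp_Hausdorff_space)

text \<open>Countability of the index type makes the function space metrizable and second-countable,
  and both properties pass to subspaces. The factor spaces of a factorization are built in this
  form.\<close>

lemma tychonoff_second_countable_top_of_set:
  fixes S :: "('i::countable \<Rightarrow> real) set"
  shows "tychonoff_space (top_of_set S)" "second_countable (top_of_set S)"
  by (simp_all add: tychonoff_space_metrizable metrizable_space_subtopology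
      metrizable_space_euclidean second_countable_subtopology second_countable_euclidean)

section \<open>Factorizability and countable unions of cozero rectangles\<close>

text \<open>Write \<open>C\<close> as the set where some \<open>f\<close> is nonzero and factor
  \<open>f\<close> through \<open>h\<close>. The domain of \<open>h\<close> is second-countable,
  hence Lindelof, so the cozero set of \<open>h\<close> splits into rectangles. Their preimages
  under the two factor maps give \<open>C\<close>.\<close>

lemma R_factorizable_imp_sigma_cozero_rectangle:
  assumes "R_factorizable_prod X Y" "cozero_set_of (prod_topology X Y) C"
  shows "sigma_cozero_rectangle X Y C"
proof -
  obtain f where f: "continuous_map (prod_topology X Y) euclideanreal f"
    "C = {z \<in> topspace (prod_topology X Y). f z \<noteq> 0}"
    using assms(2) unfolding cozero_set_of_iff by blast
  obtain X' Y' :: "real topology" and g1 g2 h where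
    X': "tychonoff_space X'" "second_countable X'" and
    Y': "tychonoff_space Y'" "second_countable Y'" and
    g: "continuous_map X X' g1" "continuous_map Y Y' g2" and
    h: "continuous_map (prod_topology X' Y') euclideanreal h" and
    eq: "\<forall>x \<in> topspace X. \<forall>y \<in> topspace Y. f (x, y) = h (g1 x, g2 y)"
    using assms(1)[unfolded R_factorizable_prod_def, THEN spec, THEN mp, OF f(1)]
    by (elim exE conjE) (rule that)
  let ?D = "{z \<in> topspace (prod_topology X' Y'). h z \<noteq> 0}"
  have "cozero_set_of (prod_topology X' Y') ?D" unfolding cozero_set_of_iff using h by blast
  then have "sigma_cozero_rectangle X' Y' ?D"
    using X' Y' unfolding tychonoff_space_def
    by (intro cozero_imp_sigma_cozero_rectangle_Lindelof second_countable_imp_Lindelof_space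
        second_countable_prod_topology) auto
  then have "sigma_cozero_rectangle X Y {z \<in> topspace (prod_topology X Y). map_prod g1 g2 z \<in> ?D}"
    by (rule sigma_cozero_rectangle_preimage[OF g])
  moreover have "{z \<in> topspace (prod_topology X Y). map_prod g1 g2 z \<in> ?D} = C"
    using g eq by (auto simp: f(2) continuous_map_def)
  ultimately show ?thesis by simp
qed

lemma cozero_set_of_interval_preimage:
  assumes "continuous_map X euclideanreal f"
  shows "cozero_set_of X {x \<in> topspace X. f x \<in> {a<..<b}}"
proof -
  \<comment> \<open>This function is positive exactly where both \<open>f x - a\<close> and
    \<open>b - f x\<close> are, and 0 elsewhere.\<close>
  have "continuous_map X euclideanreal (\<lambda>x. max 0 (min (f x - a) (b - f x)))"
    using assms by (intro continuous_map_real_max continuous_map_real_min continuous_map_diff) auto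
  moreover have "{x \<in> topspace X. f x \<in> {a<..<b}} =
      {x \<in> topspace X. max 0 (min (f x - a) (b - f x)) \<noteq> 0}"
    by (auto simp: max_def min_def)
  ultimately show ?thesis unfolding cozero_set_of_iff by (intro exI conjI)
qed

lemma rational_interval_neighbourhood:
  fixes t :: real
  assumes "open U" "t \<in> U"
  obtains a b :: rat where "of_rat a < t" "t < of_rat b" "{of_rat a<..<of_rat b} \<subseteq> U"
proof -
  obtain e where e: "e > 0" "\<And>s. dist s t < e \<Longrightarrow> s \<in> U"
    using assms unfolding open_dist by blast
  obtain a where a: "t - e < of_rat a" "of_rat a < t"
    using of_rat_dense[of "t - e" t] e(1) by auto
  obtain b where b: "t < of_rat b" "of_rat b < t + e"
    using of_rat_dense[of t "t + e"] e(1) by auto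
  have "{of_rat a<..<of_rat b} \<subseteq> U"
    using a b by (auto intro!: e(2) simp: dist_real_def)
  then show thesis using that a b by blast
qed

text \<open>
  The preimages of the rational intervals are described by countably many functions on \<open>X\<close> and
  on \<open>Y\<close>; the factor spaces are the images of \<open>X\<close> and \<open>Y\<close> under these families.
\<close>

lemma sigma_cozero_rectangle_imp_R_factorizable:
  assumes "\<And>C. cozero_set_of (prod_topology X Y) C \<Longrightarrow> sigma_cozero_rectangle X Y C"
  shows "R_factorizable_prod X Y"
  unfolding R_factorizable_prod_def
proof (intro allI impI)
  fix f assume f: "continuous_map (prod_topology X Y) euclideanreal f"
  \<comment> \<open>For one rational interval, the hypothesis splits its preimage under
    \<open>f\<close> into a sequence of rectangles, and \<open>v n\<close>, \<open>w n\<close> are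
    functions defining the sides of the \<open>n\<close>-th one.\<close>
  have "\<exists>v w. (\<forall>n::nat. continuous_map X euclideanreal (v n) \<and> continuous_map Y euclideanreal (w n)) \<and>
      (\<forall>x \<in> topspace X. \<forall>y \<in> topspace Y.
         f (x, y) \<in> {of_rat a<..<of_rat b} \<longleftrightarrow> (\<exists>n. v n x \<noteq> 0 \<and> w n y \<noteq> 0))" for a b :: rat
  proof -
    have "sigma_cozero_rectangle X Y
        {z \<in> topspace (prod_topology X Y). f z \<in> {of_rat a<..<of_rat b}}" (is "sigma_cozero_rectangle _ _ ?C")
      using assms cozero_set_of_interval_preimage[OF f] by blast
    then obtain R :: "nat \<Rightarrow> _" where R: "\<And>n. cozero_rectangle X Y (R n)" "?C = (\<Union>n. R n)"
      unfolding sigma_cozero_rectangle_sequence by blast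
    have "\<forall>n. \<exists>v w. continuous_map X euclideanreal v \<and> continuous_map Y euclideanreal w \<and>
        R n = {x \<in> topspace X. v x \<noteq> 0} \<times> {y \<in> topspace Y. w y \<noteq> 0}"
      using R(1) unfolding cozero_rectangle_iff by (rule allI)
    then obtain v w where vw: "\<forall>n. continuous_map X euclideanreal (v n) \<and>
        continuous_map Y euclideanreal (w n) \<and>
        R n = {x \<in> topspace X. v n x \<noteq> 0} \<times> {y \<in> topspace Y. w n y \<noteq> 0}"
      unfolding choice_iff by (elim exE)
    have "f (x, y) \<in> {of_rat a<..<of_rat b} \<longleftrightarrow> (\<exists>n. v n x \<noteq> 0 \<and> w n y \<noteq> 0)"
      if "x \<in> topspace X" "y \<in> topspace Y" for x y
    proof -
      have "(x, y) \<in> ?C \<longleftrightarrow> (\<exists>n. (x, y) \<in> R n)" unfolding R(2) by blast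
      then show ?thesis using that vw by simp
    qed
    then show ?thesis using vw by (intro exI[of _ v] exI[of _ w] conjI allI ballI) simp_all
  qed
  then have "\<forall>a b. \<exists>v w. (\<forall>n::nat. continuous_map X euclideanreal (v n) \<and> continuous_map Y euclideanreal (w n)) \<and>
      (\<forall>x \<in> topspace X. \<forall>y \<in> topspace Y.
         f (x, y) \<in> {of_rat a<..<of_rat b} \<longleftrightarrow> (\<exists>n. v n x \<noteq> 0 \<and> w n y \<noteq> 0))"
    by (intro allI)
  then obtain v w where vw: "\<forall>a b.
      (\<forall>n::nat. continuous_map X euclideanreal (v a b n) \<and> continuous_map Y euclideanreal (w a b n)) \<and>
      (\<forall>x \<in> topspace X. \<forall>y \<in> topspace Y.
         f (x, y) \<in> {of_rat a<..<of_rat b} \<longleftrightarrow> (\<exists>n. v a b n x \<noteq> 0 \<and> w a b n y \<noteq> 0))"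
    unfolding choice_iff by (elim exE)
  have v: "continuous_map X euclideanreal (v a b n)"
    and w: "continuous_map Y euclideanreal (w a b n)" for a b n
    using vw by simp_all
  \<comment> \<open>All chosen functions on one factor are gathered into a single map. The index
    \<open>(a, b, n)\<close> ranges over a countable type, so the images are metrizable and
    second-countable.\<close>
  define G1 :: "_ \<Rightarrow> rat \<times> rat \<times> nat \<Rightarrow> real" where "G1 x = (\<lambda>(a, b, n). v a b n x)" for x
  define G2 :: "_ \<Rightarrow> rat \<times> rat \<times> nat \<Rightarrow> real" where "G2 y = (\<lambda>(a, b, n). w a b n y)" for y
  define X' where "X' = top_of_set (G1 ` topspace X)"
  define Y' where "Y' = top_of_set (G2 ` topspace Y)"
  \<comment> \<open>\<open>h\<close> evaluates \<open>f\<close> at arbitrarily chosen preimages;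
    \<open>le\<close> below shows that the choice does not matter.\<close>
  define h where
    "h = (\<lambda>(p, q). f (inv_into (topspace X) G1 p, inv_into (topspace Y) G2 q))"
  have vw': "f (x, y) \<in> {of_rat a<..<of_rat b} \<longleftrightarrow>
      (\<exists>n. G1 x (a, b, n) \<noteq> 0 \<and> G2 y (a, b, n) \<noteq> 0)"
    if "x \<in> topspace X" "y \<in> topspace Y" for x y a b
    using vw that by (simp add: G1_def G2_def)
  \<comment> \<open>One inequality suffices, since the assumptions are symmetric in the two pairs.
    If it failed, a rational interval around \<open>f (x, y)\<close> would lie below
    \<open>f (x', y')\<close>. But membership of a value of \<open>f\<close> in that interval
    depends only on the values of \<open>G1\<close> and \<open>G2\<close>, so
    \<open>f (x', y')\<close> would belong to it.\<close>
  have le: "f (x', y') \<le> f (x, y)"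
    if "x \<in> topspace X" "x' \<in> topspace X" "y \<in> topspace Y" "y' \<in> topspace Y"
      "G1 x = G1 x'" "G2 y = G2 y'" for x x' y y'
  proof (rule ccontr)
    assume "\<not> f (x', y') \<le> f (x, y)"
    then obtain a b where ab: "of_rat a < f (x, y)" "f (x, y) < of_rat b"
      "{of_rat a<..<of_rat b} \<subseteq> {..<f (x', y')}"
      using rational_interval_neighbourhood[of "{..<f (x', y')}" "f (x, y)"] by auto
    then have "f (x', y') \<in> {of_rat a<..<of_rat b}"
      using vw'[of x y a b] vw'[of x' y' a b] that by simp
    then show False using ab(3) by blast
  qed
  have h_eq: "h (G1 x, G2 y) = f (x, y)" if "x \<in> topspace X" "y \<in> topspace Y" for x y
    using that unfolding h_def
    by (auto intro!: antisym le simp: inv_into_into f_inv_into_f)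
  have G: "continuous_map X X' G1" "continuous_map Y Y' G2"
    unfolding X'_def Y'_def continuous_map_in_subtopology euclidean_product_topology[symmetric]
      continuous_map_componentwise_UNIV G1_def G2_def
    using v w by auto
  have coord: "open {p :: rat \<times> rat \<times> nat \<Rightarrow> real. p k \<noteq> 0}" for k
    by (intro open_Collect_neq continuous_intros) auto
  have "openin (prod_topology X' Y') {z \<in> topspace (prod_topology X' Y'). h z \<in> U}"
    if U: "open U" for U
    unfolding openin_subopen[of _ "{z \<in> _. _ z}"]
  proof (intro ballI)
    fix z assume "z \<in> {z \<in> topspace (prod_topology X' Y'). h z \<in> U}"
    then obtain x y where xy: "x \<in> topspace X" "y \<in> topspace Y" "z = (G1 x, G2 y)" "h z \<in> U"
      by (auto simp: X'_def Y'_def)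
    then have "f (x, y) \<in> U" using h_eq by simp
    then obtain a b where ab: "of_rat a < f (x, y)" "f (x, y) < of_rat b"
      "{of_rat a<..<of_rat b} \<subseteq> U"
      using rational_interval_neighbourhood[OF U] by metis
    then obtain n where n: "G1 x (a, b, n) \<noteq> 0" "G2 y (a, b, n) \<noteq> 0"
      using vw'[OF xy(1,2), of a b] by auto
    \<comment> \<open>The \<open>n\<close>-th rectangle for the interval \<open>(a, b)\<close>
      contains the point \<open>(x, y)\<close> and is mapped by \<open>f\<close> into
      \<open>U\<close>. Its two sides are conditions on a single coordinate of \<open>G1\<close> and
      of \<open>G2\<close>, hence correspond to open sets of \<open>X'\<close> and
      \<open>Y'\<close>.\<close>
    let ?V = "G1 ` topspace X \<inter> {p. p (a, b, n) \<noteq> 0}"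
    let ?W = "G2 ` topspace Y \<inter> {q. q (a, b, n) \<noteq> 0}"
    have "openin X' ?V" "openin Y' ?W"
      unfolding X'_def Y'_def using coord by (simp_all add: openin_open_Int)
    then have "openin (prod_topology X' Y') (?V \<times> ?W)"
      by (simp add: openin_prod_Times_iff)
    moreover have "z \<in> ?V \<times> ?W" using xy n by simp
    moreover have "?V \<times> ?W \<subseteq> {z \<in> topspace (prod_topology X' Y'). h z \<in> U}"
    proof clarsimp
      fix s t assume st: "s \<in> topspace X" "t \<in> topspace Y"
        "G1 s (a, b, n) \<noteq> 0" "G2 t (a, b, n) \<noteq> 0"
      then have "f (s, t) \<in> U" using vw'[OF st(1,2), of a b] ab(3) by blast
      then show "G1 s \<in> topspace X' \<and> G2 t \<in> topspace Y' \<and> h (G1 s, G2 t) \<in> U"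
        using st h_eq by (simp add: X'_def Y'_def)
    qed
    ultimately show "\<exists>T. openin (prod_topology X' Y') T \<and> z \<in> T \<and>
        T \<subseteq> {z \<in> topspace (prod_topology X' Y'). h z \<in> U}" by blast
  qed
  then have h: "continuous_map (prod_topology X' Y') euclideanreal h"
    by (simp add: continuous_map_def)
  show "\<exists>(X' :: real topology) (Y' :: real topology) g1 g2 h.
           tychonoff_space X' \<and> second_countable X' \<and>
           tychonoff_space Y' \<and> second_countable Y' \<and>
           continuous_map X X' g1 \<and> continuous_map Y Y' g2 \<and>
           continuous_map (prod_topology X' Y') euclideanreal h \<and>
           (\<forall>x \<in> topspace X. \<forall>y \<in> topspace Y. f (x, y) = h (g1 x, g2 y))"
    \<comment> \<open>The factor spaces consist of functions on a countable index type; they are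
      replaced by homeomorphic copies on sets of reals.\<close>
    by (rule factorization_through_real_copies[OF _ _ _ _ G h])
       (auto simp: h_eq X'_def Y'_def tychonoff_second_countable_top_of_set)
qed

lemma R_factorizable_prod_iff:
  "R_factorizable_prod X Y \<longleftrightarrow>
     (\<forall>C. cozero_set_of (prod_topology X Y) C \<longrightarrow> sigma_cozero_rectangle X Y C)"
  using R_factorizable_imp_sigma_cozero_rectangle sigma_cozero_rectangle_imp_R_factorizable by blast

lemma R_factorizable_prod_Lindelof:
  assumes "tychonoff_space X" "tychonoff_space Y" "Lindelof_space (prod_topology X Y)"
  shows "R_factorizable_prod X Y"
  using assms cozero_imp_sigma_cozero_rectangle_Lindelof
  unfolding R_factorizable_prod_iff tychonoff_space_def by blast

section \<open>Cozero sets along embeddings\<close>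

text \<open>Restates \<open>z\<close>-embedding of the image as an extension property of cozero sets
  of \<open>X\<close> itself. Cozero sets travel between \<open>X\<close> and the image along the
  embedding and its inverse \<open>q\<close>, and complements exchange zero and cozero sets.\<close>

lemma z_embedded_in_embedding_image:
  assumes "embedding_map X T i"
  shows "z_embedded_in (i ` topspace X) T \<longleftrightarrow>
     (\<forall>C. cozero_set_of X C \<longrightarrow>
        (\<exists>D. cozero_set_of T D \<and> C = {x \<in> topspace X. i x \<in> D}))"
proof -
  let ?S = "i ` topspace X"
  obtain q where q: "homeomorphic_maps X (subtopology T ?S) i q"
    using assms unfolding embedding_map_def homeomorphic_map_maps by blast
  have i: "continuous_map X (subtopology T ?S) i" and q': "continuous_map (subtopology T ?S) X q"
    and qi: "\<And>x. x \<in> topspace X \<Longrightarrow> q (i x) = x"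
    using q unfolding homeomorphic_maps_def by auto
  have S: "?S \<subseteq> topspace T"
    using continuous_map_image_subset_topspace[OF i] by simp
  then have top: "topspace (subtopology T ?S) = ?S" by auto
  show ?thesis
  proof
    assume L: "z_embedded_in ?S T"
    show "\<forall>C. cozero_set_of X C \<longrightarrow> (\<exists>D. cozero_set_of T D \<and> C = {x \<in> topspace X. i x \<in> D})"
    proof (intro allI impI)
      fix C assume C: "cozero_set_of X C"
      have CX: "C \<subseteq> topspace X" using openin_subset[OF openin_cozero_set[OF C]] .
      have "cozero_set_of (subtopology T ?S) {u \<in> ?S. q u \<in> C}"
        using cozero_set_of_preimage[OF q' C] by (simp only: top)
      moreover have "{u \<in> ?S. q u \<in> C} = i ` C" using CX qi by auto
      ultimately have "zero_set_of (subtopology T ?S) (?S - i ` C)"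
        using CX unfolding zero_set_of_iff_cozero top by (simp add: double_diff image_mono)
      then obtain F where F: "zero_set_of T F" "F \<inter> ?S = ?S - i ` C"
        using L unfolding z_embedded_in_def by blast
      \<comment> \<open>The complement of \<open>F\<close> is the required extension of
        \<open>C\<close>; injectivity of \<open>i\<close>, witnessed by \<open>q\<close>, excludes
        points outside \<open>C\<close>.\<close>
      have "i x \<in> topspace T - F \<longleftrightarrow> x \<in> C" if x: "x \<in> topspace X" for x
      proof -
        have "i x \<in> i ` C \<longleftrightarrow> x \<in> C" using qi CX x by (metis image_iff subsetD)
        then show ?thesis using x S F(2) by blast
      qed
      then have "C = {x \<in> topspace X. i x \<in> topspace T - F}" using CX by auto
      moreover have "cozero_set_of T (topspace T - F)"
        using F(1) unfolding cozero_set_of_def by blast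
      ultimately show "\<exists>D. cozero_set_of T D \<and> C = {x \<in> topspace X. i x \<in> D}" by blast
    qed
  next
    assume R: "\<forall>C. cozero_set_of X C \<longrightarrow> (\<exists>D. cozero_set_of T D \<and> C = {x \<in> topspace X. i x \<in> D})"
    show "z_embedded_in ?S T"
      unfolding z_embedded_in_def
    proof (intro conjI allI impI S)
      fix Z assume Z: "zero_set_of (subtopology T ?S) Z"
      then have ZS: "Z \<subseteq> ?S" "cozero_set_of (subtopology T ?S) (?S - Z)"
        unfolding zero_set_of_iff_cozero top by auto
      obtain D where D: "cozero_set_of T D"
        "{x \<in> topspace X. i x \<in> ?S - Z} = {x \<in> topspace X. i x \<in> D}"
        using R cozero_set_of_preimage[OF i ZS(2)] by blast
      have "zero_set_of T (topspace T - D)"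
        using D(1) openin_subset[OF openin_cozero_set[OF D(1)]]
        unfolding zero_set_of_iff_cozero by (simp add: double_diff)
      moreover have "(topspace T - D) \<inter> ?S = Z"
      proof -
        have "i x \<in> D \<longleftrightarrow> i x \<notin> Z" if "x \<in> topspace X" for x
          using D(2) that by (simp add: set_eq_iff) blast
        then show ?thesis using S ZS(1) by auto
      qed
      ultimately show "\<exists>F. zero_set_of T F \<and> F \<inter> ?S = Z" by blast
    qed
  qed
qed

lemma embedding_map_map_prod:
  assumes "embedding_map X X' i" "embedding_map Y Y' j"
  shows "embedding_map (prod_topology X Y) (prod_topology X' Y') (map_prod i j)"
proof -
  obtain p q where p: "homeomorphic_maps X (subtopology X' (i ` topspace X)) i p"
    and q: "homeomorphic_maps Y (subtopology Y' (j ` topspace Y)) j q"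
    using assms unfolding embedding_map_def homeomorphic_map_maps by blast
  have "homeomorphic_maps (prod_topology X Y)
      (prod_topology (subtopology X' (i ` topspace X)) (subtopology Y' (j ` topspace Y)))
      (map_prod i j) (map_prod p q)"
    using p q unfolding homeomorphic_maps_def by (auto intro: continuous_map_map_prod)
  then show ?thesis
    unfolding embedding_map_def homeomorphic_map_maps
    by (auto simp: subtopology_Times map_prod_surj_on)
qed

lemma z_embedded_in_prod_image:
  assumes "embedding_map X X' i" "embedding_map Y Y' j"
  shows "z_embedded_in ((i ` topspace X) \<times> (j ` topspace Y)) (prod_topology X' Y') \<longleftrightarrow>
     (\<forall>C. cozero_set_of (prod_topology X Y) C \<longrightarrow>
        (\<exists>D. cozero_set_of (prod_topology X' Y') D \<and>
             C = {z \<in> topspace (prod_topology X Y). map_prod i j z \<in> D}))"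
proof -
  have "map_prod i j ` topspace (prod_topology X Y) = (i ` topspace X) \<times> (j ` topspace Y)"
    by (simp add: map_prod_surj_on)
  then show ?thesis
    using z_embedded_in_embedding_image[OF embedding_map_map_prod[OF assms]] by simp
qed

lemma embedding_imp_continuous_map: "embedding_map X T i \<Longrightarrow> continuous_map X T i"
  unfolding embedding_map_def
  using homeomorphic_imp_continuous_map continuous_map_in_subtopology by blast

text \<open>A cozero set of the smaller product extends to the larger one, where it splits into
  countably many rectangles; these pull back along the embeddings.\<close>

lemma R_factorizable_prod_z_embedded:
  assumes "embedding_map X X' i" "embedding_map Y Y' j" "R_factorizable_prod X' Y'"
    and "z_embedded_in ((i ` topspace X) \<times> (j ` topspace Y)) (prod_topology X' Y')"
  shows "R_factorizable_prod X Y"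
  unfolding R_factorizable_prod_iff
proof (intro allI impI)
  fix C assume "cozero_set_of (prod_topology X Y) C"
  then obtain D where D: "cozero_set_of (prod_topology X' Y') D"
    "C = {z \<in> topspace (prod_topology X Y). map_prod i j z \<in> D}"
    using assms(4) unfolding z_embedded_in_prod_image[OF assms(1,2)] by blast
  show "sigma_cozero_rectangle X Y C"
    unfolding D(2)
    using assms(3) D(1) unfolding R_factorizable_prod_iff
    by (intro sigma_cozero_rectangle_preimage[OF embedding_imp_continuous_map[OF assms(1)]
          embedding_imp_continuous_map[OF assms(2)]]) simp
qed

text \<open>Split a cozero set into rectangles and extend every side separately, using the
  \<open>z\<close>-embedding of the factors. The extended rectangles are cozero sets of the larger
  product, and so is their countable union.\<close>

lemma z_embedded_in_prod_if_R_factorizable: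
  assumes "R_factorizable_prod X Y"
    and i: "embedding_map X X' i" "z_embedded_in (i ` topspace X) X'"
    and j: "embedding_map Y Y' j" "z_embedded_in (j ` topspace Y) Y'"
  shows "z_embedded_in ((i ` topspace X) \<times> (j ` topspace Y)) (prod_topology X' Y')"
  unfolding z_embedded_in_prod_image[OF i(1) j(1)]
proof (intro allI impI)
  fix C assume "cozero_set_of (prod_topology X Y) C"
  then obtain R :: "nat \<Rightarrow> _" where R: "\<And>n. cozero_rectangle X Y (R n)" "C = (\<Union>n. R n)"
    using assms(1) unfolding R_factorizable_prod_iff sigma_cozero_rectangle_sequence by blast
  have "\<exists>D. cozero_rectangle X' Y' D \<and> R n = {z \<in> topspace (prod_topology X Y). map_prod i j z \<in> D}" for n
  proof -
    obtain V W where VW: "cozero_set_of X V" "cozero_set_of Y W" "R n = V \<times> W"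
      using R(1) unfolding cozero_rectangle_def by blast
    obtain V' where V': "cozero_set_of X' V'" "V = {x \<in> topspace X. i x \<in> V'}"
      using VW(1) i(2) unfolding z_embedded_in_embedding_image[OF i(1)] by blast
    obtain W' where W': "cozero_set_of Y' W'" "W = {y \<in> topspace Y. j y \<in> W'}"
      using VW(2) j(2) unfolding z_embedded_in_embedding_image[OF j(1)] by blast
    have "cozero_rectangle X' Y' (V' \<times> W')"
      unfolding cozero_rectangle_def using V'(1) W'(1) by blast
    moreover have "R n = {z \<in> topspace (prod_topology X Y). map_prod i j z \<in> V' \<times> W'}"
      unfolding VW(3) V'(2) W'(2) by auto
    ultimately show ?thesis by (intro exI[of _ "V' \<times> W'"] conjI)
  qed
  then obtain D where D: "\<And>n. cozero_rectangle X' Y' (D n)"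
    "\<And>n. R n = {z \<in> topspace (prod_topology X Y). map_prod i j z \<in> D n}" by metis
  have "cozero_set_of (prod_topology X' Y') (\<Union>n. D n)"
    using D(1) cozero_set_of_cozero_rectangle by (intro cozero_set_of_UN) blast
  moreover have "C = {z \<in> topspace (prod_topology X Y). map_prod i j z \<in> (\<Union>n. D n)}"
    using R(2) D(2) by auto
  ultimately show "\<exists>D. cozero_set_of (prod_topology X' Y') D \<and>
      C = {z \<in> topspace (prod_topology X Y). map_prod i j z \<in> D}" by blast
qed

section \<open>The Stone-Cech compactification\<close>

lemma tychonoff_space_beta: "tychonoff_space (beta X)"
  using compact_Hausdorff_beta[of X]
  unfolding tychonoff_space_def
  by (simp add: compact_Hausdorff_or_regular_imp_normal_space normal_imp_completely_regular_space)

lemma z_embedded_in_beta: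
  assumes "tychonoff_space X"
  shows "z_embedded_in (beta_map X ` topspace X) (beta X)"
  unfolding z_embedded_in_embedding_image[OF embedding_map_beta_map[OF assms]]
proof (intro allI impI)
  fix C assume "cozero_set_of X C"
  then obtain f where f: "continuous_map X euclideanreal f" "C = {x \<in> topspace X. f x \<noteq> 0}"
    unfolding cozero_set_of_iff by blast
  \<comment> \<open>Truncating the absolute value of \<open>f\<close> at 1 keeps its zeros and gives
    values in the unit interval, so the result extends over \<open>beta X\<close>.\<close>
  have "continuous_map X (top_of_set {0..1}) (\<lambda>x. min 1 \<bar>f x\<bar>)"
    using f(1)
    by (auto simp: continuous_map_in_subtopology
        intro!: continuous_map_real_min continuous_map_real_abs)
  then obtain F where F: "continuous_map (beta X) (top_of_set {0..1}) F"
    "\<And>x. x \<in> topspace X \<Longrightarrow> F (beta_map X x) = min 1 \<bar>f x\<bar>"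
    using beta_extension by blast
  let ?D = "{u \<in> topspace (beta X). F u \<noteq> 0}"
  have "cozero_set_of (beta X) ?D"
    unfolding cozero_set_of_iff using F(1) by (auto simp: continuous_map_in_subtopology)
  moreover have "C = {x \<in> topspace X. beta_map X x \<in> ?D}"
    using F(2) f(2) embedding_imp_continuous_map[OF embedding_map_beta_map[OF assms]]
    by (auto simp: continuous_map_def min_def split: if_splits)
  ultimately show "\<exists>D. cozero_set_of (beta X) D \<and> C = {x \<in> topspace X. beta_map X x \<in> D}"
    by blast
qed

lemma Lindelof_space_prod_beta: "Lindelof_space (prod_topology (beta X) (beta Y))"
  by (simp add: compact_imp_Lindelof_space compact_space_prod_topology compact_Hausdorff_beta)

section \<open>The equivalences\<close>

lemma R_factorizable_imp_z_embedded_in_all_z_extensions: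
  "R_factorizable_prod X Y \<Longrightarrow> z_embedded_in_all_z_extensions TYPE('c) TYPE('d) X Y"
  unfolding z_embedded_in_all_z_extensions_def
  using z_embedded_in_prod_if_R_factorizable by blast

lemma z_embedded_in_some_R_factorizable_prod_imp_R_factorizable:
  "z_embedded_in_some_R_factorizable_prod TYPE('c) TYPE('d) X Y \<Longrightarrow> R_factorizable_prod X Y"
  unfolding z_embedded_in_some_R_factorizable_prod_def
  using R_factorizable_prod_z_embedded by blast

lemma z_embedded_in_some_Lindelof_prod_imp_R_factorizable_prod:
  "z_embedded_in_some_Lindelof_prod TYPE('c) TYPE('d) X Y \<Longrightarrow>
     z_embedded_in_some_R_factorizable_prod TYPE('c) TYPE('d) X Y"
  unfolding z_embedded_in_some_Lindelof_prod_def z_embedded_in_some_R_factorizable_prod_def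
  using R_factorizable_prod_Lindelof by blast

theorem proposition2p1:
  fixes X :: "'a topology" and Y :: "'b topology"
  assumes "tychonoff_space X" and "tychonoff_space Y"
  shows
    "(R_factorizable_prod X Y \<longleftrightarrow>
        (\<forall>C. cozero_set_of (prod_topology X Y) C \<longrightarrow>
           (\<exists>\<R>. countable \<R> \<and> (\<forall>R \<in> \<R>. cozero_rectangle X Y R) \<and> C = \<Union>\<R>))) \<and>
     (R_factorizable_prod X Y \<longleftrightarrow>
        z_embedded_in ((beta_map X ` topspace X) \<times> (beta_map Y ` topspace Y))
          (prod_topology (beta X) (beta Y))) \<and>
     (R_factorizable_prod X Y \<longleftrightarrow>
        z_embedded_in_all_z_extensions
          TYPE(('a \<Rightarrow> real) \<Rightarrow> real) TYPE(('b \<Rightarrow> real) \<Rightarrow> real) X Y) \<and>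
     (R_factorizable_prod X Y \<longrightarrow>
        z_embedded_in_all_z_extensions TYPE('c) TYPE('d) X Y) \<and>
     (R_factorizable_prod X Y \<longleftrightarrow>
        z_embedded_in_some_R_factorizable_prod
          TYPE(('a \<Rightarrow> real) \<Rightarrow> real) TYPE(('b \<Rightarrow> real) \<Rightarrow> real) X Y) \<and>
     (z_embedded_in_some_R_factorizable_prod TYPE('e) TYPE('f) X Y \<longrightarrow>
        R_factorizable_prod X Y) \<and>
     (R_factorizable_prod X Y \<longleftrightarrow>
        z_embedded_in_some_Lindelof_prod
          TYPE(('a \<Rightarrow> real) \<Rightarrow> real) TYPE(('b \<Rightarrow> real) \<Rightarrow> real) X Y) \<and>
     (z_embedded_in_some_Lindelof_prod TYPE('g) TYPE('h) X Y \<longrightarrow>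
        R_factorizable_prod X Y)"
proof -
  note emb = embedding_map_beta_map[OF assms(1)] embedding_map_beta_map[OF assms(2)]
  note z = z_embedded_in_beta[OF assms(1)] z_embedded_in_beta[OF assms(2)]
  let ?z3 = "z_embedded_in ((beta_map X ` topspace X) \<times> (beta_map Y ` topspace Y))
          (prod_topology (beta X) (beta Y))"
  let ?z4 = "z_embedded_in_all_z_extensions
          TYPE(('a \<Rightarrow> real) \<Rightarrow> real) TYPE(('b \<Rightarrow> real) \<Rightarrow> real) X Y"
  let ?z5 = "z_embedded_in_some_R_factorizable_prod
          TYPE(('a \<Rightarrow> real) \<Rightarrow> real) TYPE(('b \<Rightarrow> real) \<Rightarrow> real) X Y"
  let ?z6 = "z_embedded_in_some_Lindelof_prod
          TYPE(('a \<Rightarrow> real) \<Rightarrow> real) TYPE(('b \<Rightarrow> real) \<Rightarrow> real) X Y"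
  have 12: "R_factorizable_prod X Y \<longleftrightarrow>
        (\<forall>C. cozero_set_of (prod_topology X Y) C \<longrightarrow>
           (\<exists>\<R>. countable \<R> \<and> (\<forall>R \<in> \<R>. cozero_rectangle X Y R) \<and> C = \<Union>\<R>))"
    unfolding R_factorizable_prod_iff sigma_cozero_rectangle_def ..
  \<comment> \<open>Besides \<open>12\<close>, the equivalences come from the cycle (1), (4), (3),
    (6), (5), (1). The point types of \<open>?z4\<close>, \<open>?z5\<close> and \<open>?z6\<close>
    are those of \<open>beta X\<close> and \<open>beta Y\<close>, so these two spaces can
    instantiate (4) and witness (6).\<close>
  have 43: "?z4 \<Longrightarrow> ?z3"
    unfolding z_embedded_in_all_z_extensions_def
    by (elim allE[of _ "beta X"] allE[of _ "beta Y"] allE[of _ "beta_map X"] allE[of _ "beta_map Y"])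
       (simp add: emb z tychonoff_space_beta)
  have 36: "?z3 \<Longrightarrow> ?z6"
    unfolding z_embedded_in_some_Lindelof_prod_def
    by (rule exI[of _ "beta X"], rule exI[of _ "beta Y"], rule exI[of _ "beta_map X"],
        rule exI[of _ "beta_map Y"]) (simp add: emb tychonoff_space_beta Lindelof_space_prod_beta)
  have 65: "?z6 \<Longrightarrow> ?z5"
    by (rule z_embedded_in_some_Lindelof_prod_imp_R_factorizable_prod)
  have 51: "?z5 \<Longrightarrow> R_factorizable_prod X Y"
    by (rule z_embedded_in_some_R_factorizable_prod_imp_R_factorizable)
  have 14: "R_factorizable_prod X Y \<Longrightarrow> ?z4"
    by (rule R_factorizable_imp_z_embedded_in_all_z_extensions)
  have "R_factorizable_prod X Y \<longleftrightarrow> ?z3" "R_factorizable_prod X Y \<longleftrightarrow> ?z4"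
    "R_factorizable_prod X Y \<longleftrightarrow> ?z5" "R_factorizable_prod X Y \<longleftrightarrow> ?z6"
    using 14 43 36 65 51 by iprover+
  then show ?thesis
    \<comment> \<open>The conjuncts left after the equivalences are the one-directional implications
      for arbitrary point types; for (6) the passage goes through (5).\<close>
    by (intro conjI impI 12)
       (assumption | erule R_factorizable_imp_z_embedded_in_all_z_extensions
         z_embedded_in_some_R_factorizable_prod_imp_R_factorizable
         z_embedded_in_some_R_factorizable_prod_imp_R_factorizable[OF
           z_embedded_in_some_Lindelof_prod_imp_R_factorizable_prod])+
qed

end
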